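(* Let $X$ be any topological space. Then the Type-I setwise topology $\mathfrak{W}_{s1}$ and the Type-II setwise topology $\mathfrak{W}_{s2}$ on $\mathcal{M}(X)$ are equivalent, i.e. they are the same topology on $\mathcal{M}(X)$.
   Context: For a topological space $X$ with Borel $\sigma$-algebra $\mathcal{B}$, $\mathcal{M}(X)$ denotes the set of all probability measures on $(X,\mathcal{B})$, and $M_b(X)$ denotes the set of bounded Borel-measurable functions $X\to\mathbb{R}$. The Type-I setwise topology $\mathfrak{W}_{s1}$ is the topology on $\mathcal{M}(X)$ with subbasis consisting of the sets $W_{s1}(\nu,A,\epsilon)=\{\varrho\in\mathcal{M}(X): |\varrho(A)-\nu(A)|<\epsilon\}$ for $\nu\in\mathcal{M}(X)$, $A\in\mathcal{B}$, $\epsilon>0$. The Type-II setwise topology $\mathfrak{W}_{s2}$ is the topology generated (as a subbasis) by the sets $W_{s2}(\nu,f,\epsilon)=\{\varrho\in\mathcal{M}(X): |\int_X f\,d\varrho-\int_X f\,d\nu|<\epsilon\}$ for $\nu\in\mathcal{M}(X)$, $f\in M_b(X)$, $\epsilon>0$. *)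

theory Defs
  imports "HOL-Probability.Probability"
begin

text \<open>A topological space is a value of type \<^typ>\<open>'a topology\<close>; its points are
  \<^term>\<open>topspace X\<close>, which need not be the whole type and may be empty.\<close>

definition borel_of :: "'a topology \<Rightarrow> 'a measure" where
  "borel_of X = sigma (topspace X) {U. openin X U}"

text \<open>A value of type \<^typ>\<open>'a measure\<close> carries its own space and sigma-algebra, and its measure
  function vanishes outside that sigma-algebra. Fixing \<^const>\<open>sets\<close> (which also fixes
  \<^const>\<open>space\<close>) thus makes the elements below correspond one-to-one to the probability
  measures on the Borel sets of \<open>X\<close>.\<close>

definition prob_measures :: "'a topology \<Rightarrow> 'a measure set" where
  "prob_measures X = {M. prob_space M \<and> sets M = sets (borel_of X)}"

text \<open>The values of \<open>f\<close> outside \<^term>\<open>topspace X\<close> are irrelevant to membership here and to the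
  integrals below.\<close>

definition bounded_measurable :: "'a topology \<Rightarrow> ('a \<Rightarrow> real) set" where
  "bounded_measurable X = {f \<in> borel_measurable (borel_of X). bounded (f ` topspace X)}"

definition W_s1 :: "'a topology \<Rightarrow> 'a measure \<Rightarrow> 'a set \<Rightarrow> real \<Rightarrow> 'a measure set" where
  "W_s1 X \<nu> A \<epsilon> = {\<rho> \<in> prob_measures X. \<bar>measure \<rho> A - measure \<nu> A\<bar> < \<epsilon>}"

definition W_s2 :: "'a topology \<Rightarrow> 'a measure \<Rightarrow> ('a \<Rightarrow> real) \<Rightarrow> real \<Rightarrow> 'a measure set" where
  "W_s2 X \<nu> f \<epsilon> = {\<rho> \<in> prob_measures X. \<bar>(\<integral>x. f x \<partial>\<rho>) - (\<integral>x. f x \<partial>\<nu>)\<bar> < \<epsilon>}"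

definition setwise_topology_1 :: "'a topology \<Rightarrow> 'a measure topology" where
  "setwise_topology_1 X = topology_generated_by
     {W_s1 X \<nu> A \<epsilon> | \<nu> A \<epsilon>. \<nu> \<in> prob_measures X \<and> A \<in> sets (borel_of X) \<and> \<epsilon> > 0}"

definition setwise_topology_2 :: "'a topology \<Rightarrow> 'a measure topology" where
  "setwise_topology_2 X = topology_generated_by
     {W_s2 X \<nu> f \<epsilon> | \<nu> f \<epsilon>. \<nu> \<in> prob_measures X \<and> f \<in> bounded_measurable X \<and> \<epsilon> > 0}"

text \<open>The underlying set of a generated topology is the union of the subbasis; for both subbases
  this is all of \<^term>\<open>prob_measures X\<close>.\<close>

lemma topspace_setwise_topology_1: "topspace (setwise_topology_1 X) = prob_measures X"
proof
  show "topspace (setwise_topology_1 X) \<subseteq> prob_measures X"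
    unfolding setwise_topology_1_def topology_generated_by_topspace W_s1_def by blast
  show "prob_measures X \<subseteq> topspace (setwise_topology_1 X)"
  proof
    fix \<rho> assume \<rho>: "\<rho> \<in> prob_measures X"
    have "\<rho> \<in> W_s1 X \<rho> {} 1"
      using \<rho> by (simp add: W_s1_def)
    moreover have "{} \<in> sets (borel_of X)" "(0::real) < 1"
      by simp_all
    ultimately show "\<rho> \<in> topspace (setwise_topology_1 X)"
      unfolding setwise_topology_1_def topology_generated_by_topspace using \<rho> by blast
  qed
qed

lemma topspace_setwise_topology_2: "topspace (setwise_topology_2 X) = prob_measures X"
proof
  show "topspace (setwise_topology_2 X) \<subseteq> prob_measures X"
    unfolding setwise_topology_2_def topology_generated_by_topspace W_s2_def by blast
  show "prob_measures X \<subseteq> topspace (setwise_topology_2 X)"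
  proof
    fix \<rho> assume \<rho>: "\<rho> \<in> prob_measures X"
    have "\<rho> \<in> W_s2 X \<rho> (\<lambda>x. 0) 1"
      using \<rho> by (simp add: W_s2_def)
    moreover have "bounded ((\<lambda>x. 0::real) ` topspace X)"
      by (rule boundedI[of _ 0]) auto
    then have "(\<lambda>x. 0) \<in> bounded_measurable X" "(0::real) < 1"
      by (simp_all add: bounded_measurable_def)
    ultimately show "\<rho> \<in> topspace (setwise_topology_2 X)"
      unfolding setwise_topology_2_def topology_generated_by_topspace using \<rho> by blast
  qed
qed

end

theory Submission
  imports Defs
begin

text \<open>The indicator function of \<open>A\<close> turns each type-I subbasic set into a type-II one. Conversely,
  a bounded measurable \<open>f\<close> is uniformly approximated by \<open>\<lambda>x. \<lfloor>n * f x\<rfloor> / n\<close>, which takes finitely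
  many values, so that its integral is a finite linear combination of measures of Borel sets and
  hence continuous in the type-I topology; \<open>\<rho> \<mapsto> \<integral>x. f x \<partial>\<rho>\<close> is then a uniform limit of continuous
  functions.\<close>

lemma space_borel_of [simp]: "space (borel_of X) = topspace X"
  unfolding borel_of_def by (rule space_measure_of) (auto dest: openin_subset)

lemma prob_measuresD:
  assumes "\<rho> \<in> prob_measures X"
  shows "prob_space \<rho>" "sets \<rho> = sets (borel_of X)" "space \<rho> = topspace X"
  using assms sets_eq_imp_space_eq[of \<rho> "borel_of X"] by (auto simp: prob_measures_def)

lemma integrable_bounded_measurable:
  assumes \<rho>: "\<rho> \<in> prob_measures X" and f: "f \<in> bounded_measurable X"
  shows "integrable \<rho> f"
proof -
  interpret prob_space \<rho> using prob_measuresD[OF \<rho>] by simp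
  obtain B where "\<And>x. x \<in> topspace X \<Longrightarrow> \<bar>f x\<bar> \<le> B"
    using f by (auto simp: bounded_measurable_def bounded_iff)
  moreover have "f \<in> borel_measurable \<rho>"
    using f prob_measuresD(2)[OF \<rho>] by (simp add: bounded_measurable_def cong: measurable_cong_sets)
  ultimately show ?thesis
    by (intro integrable_const_bound[where B = B]) (auto simp: prob_measuresD(3)[OF \<rho>])
qed

lemma continuous_map_measure_setwise_1:
  assumes A: "A \<in> sets (borel_of X)"
  shows "continuous_map (setwise_topology_1 X) euclideanreal (\<lambda>\<rho>. measure \<rho> A)"
  unfolding continuous_map_def topspace_setwise_topology_1
proof (intro conjI allI impI)
  fix U :: "real set" assume U: "openin euclidean U"
  show "openin (setwise_topology_1 X) {\<rho> \<in> prob_measures X. measure \<rho> A \<in> U}"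
  proof (subst openin_subopen, safe)
    fix \<rho> assume \<rho>: "\<rho> \<in> prob_measures X" "measure \<rho> A \<in> U"
    obtain e where e: "e > 0" "\<And>y. \<bar>y - measure \<rho> A\<bar> < e \<Longrightarrow> y \<in> U"
      using U \<rho>(2) by (auto simp: open_dist dist_real_def)
    \<comment> \<open>The centre of a subbasic set may be any element of
      \<open>prob_measures X\<close>, so \<open>\<rho>\<close> itself is taken as centre.\<close>
    have "openin (setwise_topology_1 X) (W_s1 X \<rho> A e)"
      unfolding setwise_topology_1_def using A \<rho>(1) e(1)
      by (intro topology_generated_by_Basis) blast
    moreover have "\<rho> \<in> W_s1 X \<rho> A e" "W_s1 X \<rho> A e \<subseteq> {\<rho> \<in> prob_measures X. measure \<rho> A \<in> U}"
      using \<rho> e by (auto simp: W_s1_def)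
    ultimately show "\<exists>T. openin (setwise_topology_1 X) T \<and> \<rho> \<in> T \<and>
        T \<subseteq> {\<rho> \<in> prob_measures X. measure \<rho> A \<in> U}"
      by blast
  qed
qed simp

text \<open>Splitting \<open>topspace X\<close> into the finitely many fibres of \<open>g\<close>
  writes the integral as a finite linear combination of measures of Borel sets, each of which
  depends continuously on the measure.\<close>

lemma continuous_map_integral_finite_range:
  fixes g :: "'a \<Rightarrow> real"
  assumes g: "g \<in> borel_measurable (borel_of X)" and fin: "finite (g ` topspace X)"
  shows "continuous_map (setwise_topology_1 X) euclideanreal (\<lambda>\<rho>. \<integral>x. g x \<partial>\<rho>)"
proof -
  define A where "A c = g -` {c} \<inter> topspace X" for c
  have A: "A c \<in> sets (borel_of X)" for c
    using measurable_sets[OF g, of "{c}"] by (simp add: A_def)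
  have "continuous_map (setwise_topology_1 X) euclideanreal
      (\<lambda>\<rho>. \<Sum>c\<in>g ` topspace X. c * measure \<rho> (A c))"
    using fin by (intro continuous_map_sum continuous_map_real_mult continuous_map_measure_setwise_1 A)
      auto
  moreover have "(\<integral>x. g x \<partial>\<rho>) = (\<Sum>c\<in>g ` topspace X. c * measure \<rho> (A c))"
    if \<rho>: "\<rho> \<in> prob_measures X" for \<rho>
  proof -
    interpret prob_space \<rho> using prob_measuresD[OF \<rho>] by simp
    have "(\<integral>x. g x \<partial>\<rho>) = (\<integral>x. (\<Sum>c\<in>g ` topspace X. c * indicator (A c) x) \<partial>\<rho>)"
    proof (rule Bochner_Integration.integral_cong[OF refl])
      fix x assume "x \<in> space \<rho>"
      then have x: "x \<in> topspace X" by (simp add: prob_measuresD(3)[OF \<rho>])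
      \<comment> \<open>The point \<open>x\<close> lies in exactly one fibre, so only the summand
        \<open>c = g x\<close> survives.\<close>
      have "(\<Sum>c\<in>g ` topspace X. c * indicator (A c) x) = (\<Sum>c\<in>g ` topspace X. if c = g x then c else 0)"
        using x by (intro sum.cong) (auto simp: A_def)
      then show "g x = (\<Sum>c\<in>g ` topspace X. c * indicator (A c) x)"
        using x fin by simp
    qed
    also have "\<dots> = (\<Sum>c\<in>g ` topspace X. c * measure \<rho> (A c))"
      using A prob_measuresD(2)[OF \<rho>]
      by (subst Bochner_Integration.integral_sum) (auto simp: emeasure_eq_measure)
    finally show ?thesis .
  qed
  ultimately show ?thesis
    \<comment> \<open>The formula is known only for members of \<open>prob_measures X\<close>; this
      suffices, since they form the whole topspace.\<close>
    by (elim continuous_map_eq) (simp add: topspace_setwise_topology_1)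
qed

text \<open>Values are rounded down to multiples of \<open>e\<close>. Boundedness of
  \<open>f\<close> leaves finitely many multiples over \<open>topspace X\<close>, while the rounding
  error is at most \<open>e\<close> at every \<open>x\<close>, even outside
  \<open>topspace X\<close>.\<close>

lemma bounded_measurable_finite_range_approx:
  assumes f: "f \<in> bounded_measurable X" and "e > 0"
  obtains g where "g \<in> bounded_measurable X" "finite (g ` topspace X)" "\<And>x. \<bar>f x - g x\<bar> \<le> e"
proof
  \<comment> \<open>Here \<open>e\<close> takes the place of \<open>1 / n\<close>.\<close>
  define g where "g x = real_of_int \<lfloor>f x / e\<rfloor> * e" for x
  have [measurable]: "f \<in> borel_measurable (borel_of X)"
    using f by (simp add: bounded_measurable_def)
  obtain B where B: "\<And>x. x \<in> topspace X \<Longrightarrow> \<bar>f x\<bar> \<le> B"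
    using f by (auto simp: bounded_measurable_def bounded_iff)
  have "g ` topspace X \<subseteq> (\<lambda>k. real_of_int k * e) ` {\<lfloor>- B / e\<rfloor>..\<lfloor>B / e\<rfloor>}"
  proof safe
    fix x assume "x \<in> topspace X"
    then have "- B \<le> f x" "f x \<le> B" using B[of x] by auto
    then have "- B / e \<le> f x / e" "f x / e \<le> B / e"
      using \<open>e > 0\<close> by (simp_all only: divide_right_mono less_imp_le)
    then show "g x \<in> (\<lambda>k. real_of_int k * e) ` {\<lfloor>- B / e\<rfloor>..\<lfloor>B / e\<rfloor>}"
      unfolding g_def by (intro imageI) (auto simp only: atLeastAtMost_iff floor_mono)
  qed
  then show fin: "finite (g ` topspace X)" by (rule finite_subset) simp
  have "g \<in> borel_measurable (borel_of X)" unfolding g_def by measurable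
  with fin show "g \<in> bounded_measurable X"
    by (simp add: bounded_measurable_def finite_imp_bounded)
  show "\<bar>f x - g x\<bar> \<le> e" for x
  proof -
    have "f x - g x = (f x / e - \<lfloor>f x / e\<rfloor>) * e"
      using \<open>e > 0\<close> by (simp add: g_def left_diff_distrib)
    moreover have "\<bar>f x / e - \<lfloor>f x / e\<rfloor>\<bar> \<le> 1" by linarith
    ultimately show ?thesis
      using \<open>e > 0\<close> by (simp add: abs_mult)
  qed
qed

text \<open>Total mass 1 makes the bound independent of \<open>\<rho>\<close>, so a single
  approximation \<open>g\<close> serves all measures at once.\<close>

lemma integral_uniformly_close:
  assumes \<rho>: "\<rho> \<in> prob_measures X" and f: "f \<in> bounded_measurable X"
    and g: "g \<in> bounded_measurable X" and le: "\<And>x. \<bar>f x - g x\<bar> \<le> e"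
  shows "\<bar>(\<integral>x. f x \<partial>\<rho>) - (\<integral>x. g x \<partial>\<rho>)\<bar> \<le> e"
proof -
  interpret prob_space \<rho> using prob_measuresD[OF \<rho>] by simp
  have int: "integrable \<rho> f" "integrable \<rho> g"
    using integrable_bounded_measurable \<rho> f g by blast+
  have "\<bar>(\<integral>x. f x \<partial>\<rho>) - (\<integral>x. g x \<partial>\<rho>)\<bar> = \<bar>\<integral>x. f x - g x \<partial>\<rho>\<bar>"
    using int by simp
  also have "\<dots> \<le> (\<integral>x. \<bar>f x - g x\<bar> \<partial>\<rho>)"
    by (rule integral_abs_bound)
  also have "\<dots> \<le> e"
    using int le by (intro integral_le_const) auto
  finally show ?thesis .
qed

lemma openin_setwise_1_W_s2:
  assumes \<nu>: "\<nu> \<in> prob_measures X" and f: "f \<in> bounded_measurable X"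
  shows "openin (setwise_topology_1 X) (W_s2 X \<nu> f \<epsilon>)"
proof (subst openin_subopen, safe)
  fix \<rho> assume "\<rho> \<in> W_s2 X \<nu> f \<epsilon>"
  then have \<rho>: "\<rho> \<in> prob_measures X" and lt: "\<bar>(\<integral>x. f x \<partial>\<rho>) - (\<integral>x. f x \<partial>\<nu>)\<bar> < \<epsilon>"
    by (auto simp: W_s2_def)
  \<comment> \<open>One third of the slack at \<open>\<rho>\<close>: replacing \<open>f\<close> by
    \<open>g\<close> under \<open>\<sigma>\<close>, moving from \<open>\<sigma>\<close> to
    \<open>\<rho>\<close>, and returning from \<open>g\<close> to \<open>f\<close> under
    \<open>\<rho>\<close> each cost at most \<open>d\<close>, the middle move strictly less.\<close>
  define d where "d = (\<epsilon> - \<bar>(\<integral>x. f x \<partial>\<rho>) - (\<integral>x. f x \<partial>\<nu>)\<bar>) / 3"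
  have d: "d > 0" using lt by (simp add: d_def)
  obtain g where g: "g \<in> bounded_measurable X" "finite (g ` topspace X)" "\<And>x. \<bar>f x - g x\<bar> \<le> d"
    using bounded_measurable_finite_range_approx[OF f d] by blast
  \<comment> \<open>The preimage of a ball under the continuous map given by integrating
    \<open>g\<close>.\<close>
  define T where "T = {\<sigma> \<in> topspace (setwise_topology_1 X). (\<integral>x. g x \<partial>\<sigma>) \<in> ball (\<integral>x. g x \<partial>\<rho>) d}"
  have "openin (setwise_topology_1 X) T"
    unfolding T_def using g(1,2)
    by (intro openin_continuous_map_preimage[OF continuous_map_integral_finite_range])
      (auto simp: bounded_measurable_def)
  moreover have "\<rho> \<in> T"
    using \<rho> d by (simp add: T_def topspace_setwise_topology_1)
  moreover have "T \<subseteq> W_s2 X \<nu> f \<epsilon>"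
  proof
    fix \<sigma> assume "\<sigma> \<in> T"
    then have \<sigma>: "\<sigma> \<in> prob_measures X" "\<bar>(\<integral>x. g x \<partial>\<rho>) - (\<integral>x. g x \<partial>\<sigma>)\<bar> < d"
      by (auto simp: T_def topspace_setwise_topology_1 dist_real_def)
    have "\<bar>(\<integral>x. f x \<partial>\<sigma>) - (\<integral>x. f x \<partial>\<nu>)\<bar> < \<epsilon>"
      using integral_uniformly_close[OF \<sigma>(1) f g(1,3)] integral_uniformly_close[OF \<rho> f g(1,3)]
        \<sigma>(2) d_def by argo
    with \<sigma>(1) show "\<sigma> \<in> W_s2 X \<nu> f \<epsilon>" by (simp add: W_s2_def)
  qed
  ultimately show "\<exists>T. openin (setwise_topology_1 X) T \<and> \<rho> \<in> T \<and> T \<subseteq> W_s2 X \<nu> f \<epsilon>"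
    by blast
qed

lemma indicator_bounded_measurable:
  assumes "A \<in> sets (borel_of X)"
  shows "indicator A \<in> bounded_measurable X"
  using assms by (auto simp: bounded_measurable_def bounded_iff indicator_def intro!: exI[of _ 1])

text \<open>Integrating an indicator returns the measure of the set, so every type-I subbasic set is
  type-II subbasic with the same centre and radius.\<close>

lemma W_s1_eq_W_s2_indicator:
  assumes "\<nu> \<in> prob_measures X" and A: "A \<in> sets (borel_of X)"
  shows "W_s1 X \<nu> A \<epsilon> = W_s2 X \<nu> (indicator A) \<epsilon>"
proof -
  have "(\<integral>x. indicator A x \<partial>\<rho>) = measure \<rho> A" if "\<rho> \<in> prob_measures X" for \<rho>
    \<comment> \<open>The integral of the indicator is the measure of \<open>A\<close> intersected
      with the space; the inclusion of \<open>A\<close> in \<open>topspace X\<close> removes the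
      intersection.\<close>
    using A sets.sets_into_space[OF A] prob_measuresD(3)[OF that] by (simp add: Int_absorb2)
  with assms(1) show ?thesis by (auto simp: W_s1_def W_s2_def)
qed

text \<open>The generated topology is the coarsest one in which all generators are open. Each
  inclusion between the two topologies thus reduces to a check on subbasic sets.\<close>

lemma openin_topology_generated_by_mono:
  assumes "\<And>S. S \<in> \<S> \<Longrightarrow> openin Y S" and "openin (topology_generated_by \<S>) U"
  shows "openin Y U"
  using assms generate_topology_on_coarsest[of "openin Y" \<S> U]
  by (auto simp: openin_topology_generated_by_iff)

theorem theorem2p13:
  fixes X :: "'a topology"
  shows "setwise_topology_1 X = setwise_topology_2 X"
proof (rule topology_eq[THEN iffD2], intro allI iffI)
  fix U
  assume "openin (setwise_topology_1 X) U"
  then show "openin (setwise_topology_2 X) U"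
    unfolding setwise_topology_1_def
  proof (rule openin_topology_generated_by_mono[rotated])
    fix S assume "S \<in> {W_s1 X \<nu> A \<epsilon> |\<nu> A \<epsilon>. \<nu> \<in> prob_measures X \<and> A \<in> sets (borel_of X) \<and> \<epsilon> > 0}"
    then show "openin (setwise_topology_2 X) S"
      unfolding setwise_topology_2_def
      by (intro topology_generated_by_Basis)
        (use W_s1_eq_W_s2_indicator indicator_bounded_measurable in blast)
  qed
next
  fix U
  assume "openin (setwise_topology_2 X) U"
  then show "openin (setwise_topology_1 X) U"
    unfolding setwise_topology_2_def
    \<comment> \<open>In this direction the generators are only shown to be open, not to be subbasic
      themselves.\<close>
    by (rule openin_topology_generated_by_mono[rotated]) (use openin_setwise_1_W_s2 in blast)
qed

end
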